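(* Let $a<b$ be real numbers and let $\mathfrak{L}_n:\mathfrak{C}([a,b])\to\mathfrak{B}([a,b])$, $n\in\mathbb{N}$, be a sequence of positive linear operators. Let $\langle b_n\rangle$ and $\langle c_n\rangle$ be sequences of non-negative integers with $b_n<c_n$ for all $n$ and $\lim_{n\to\infty}c_n=\infty$, let $\langle s_n\rangle$ be a sequence of non-negative real numbers with $S_n=\sum_{m=b_n+1}^{c_n}s_m>0$ for all $n$, and let $A=(a_{n,k})_{n,k\ge1}$ be a non-negative deferred weighted regular matrix (with respect to these sequences). Put $g_i(s)=s^i$ for $i=0,1,2$. Then $$stat_A^{DW}\text{-}\lim_{n}\|\mathfrak{L}_n(g_i)-g_i\|=0\quad\text{for } i=0,1,2$$ if and only if $$stat_A^{DW}\text{-}\lim_{n}\|\mathfrak{L}_n(g)-g\|=0\quad\text{for all } g\in\mathfrak{C}([a,b]).$$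
   Context: $\mathfrak{B}([a,b])$ is the normed space of all bounded real functions on $[a,b]$ with the sup-norm $\|\cdot\|$, and $\mathfrak{C}([a,b])$ is its subspace of continuous functions. A linear operator is positive if it maps non-negative functions to non-negative functions. Let $\langle b_n\rangle,\langle c_n\rangle$ be sequences of non-negative integers with $b_n<c_n$ and $c_n\to\infty$, let $\langle s_n\rangle$ be a sequence of non-negative reals, and $S_n=\sum_{m=b_n+1}^{c_n}s_m>0$. A real sequence $\langle x_n\rangle$ is deferred weighted summable to $l$ if $\lim_{n\to\infty}\frac1{S_n}\sum_{m=b_n+1}^{c_n}s_mx_m=l$. An infinite real matrix $A=(a_{n,k})_{n,k\ge 1}$ is deferred weighted regular if for every convergent sequence $x=\langle x_k\rangle$ the transform $(Ax)_n=\sum_{k=1}^\infty a_{n,k}x_k$ is defined for every $n$ and the sequence $\langle (Ax)_n\rangle$ is deferred weighted summable to $\lim_k x_k$. It is non-negative if all $a_{n,k}\ge0$. For a non-negative deferred weighted regular matrix $A$, a real sequence $\langle x_n\rangle$ is deferred weighted $A$-statistically convergent to $l$, written $stat_A^{DW}\text{-}\lim_n x_n=l$, if for every $\epsilon>0$, with $K_\epsilon=\{k\in\mathbb{N}:|x_k-l|\ge\epsilon\}$, $$\lim_{n\to\infty}\frac1{S_n}\sum_{m=b_n+1}^{c_n}\sum_{k\in K_\epsilon}s_m a_{m,k}=0.$$ *)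

theory Defs
  imports "HOL-Analysis.Analysis"
begin

text \<open>
  A real function on \<open>[a,b]\<close> is an element of \<open>extensional {a..b}\<close>, i.e. it takes the default
  value \<open>undefined\<close> outside the interval; hence two such functions are equal iff they agree
  on \<open>[a,b]\<close>. The vector space operations are pointwise on \<open>[a,b]\<close>.
\<close>

definition bounded_funs :: "real \<Rightarrow> real \<Rightarrow> (real \<Rightarrow> real) set" where
  "bounded_funs a b = {f \<in> extensional {a..b}. bounded (f ` {a..b})}"

definition continuous_funs :: "real \<Rightarrow> real \<Rightarrow> (real \<Rightarrow> real) set" where
  "continuous_funs a b = {f \<in> extensional {a..b}. continuous_on {a..b} f}"

definition sup_norm :: "real \<Rightarrow> real \<Rightarrow> (real \<Rightarrow> real) \<Rightarrow> real" where
  "sup_norm a b f = (SUP t\<in>{a..b}. \<bar>f t\<bar>)"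

definition linear_operator :: "real \<Rightarrow> real \<Rightarrow> ((real \<Rightarrow> real) \<Rightarrow> real \<Rightarrow> real) \<Rightarrow> bool" where
  "linear_operator a b T \<longleftrightarrow>
     T \<in> continuous_funs a b \<rightarrow> bounded_funs a b \<and>
     (\<forall>f\<in>continuous_funs a b. \<forall>g\<in>continuous_funs a b.
        T (\<lambda>t\<in>{a..b}. f t + g t) = (\<lambda>t\<in>{a..b}. T f t + T g t)) \<and>
     (\<forall>r. \<forall>f\<in>continuous_funs a b.
        T (\<lambda>t\<in>{a..b}. r * f t) = (\<lambda>t\<in>{a..b}. r * T f t))"

definition positive_operator :: "real \<Rightarrow> real \<Rightarrow> ((real \<Rightarrow> real) \<Rightarrow> real \<Rightarrow> real) \<Rightarrow> bool" where
  "positive_operator a b T \<longleftrightarrow>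
     (\<forall>f\<in>continuous_funs a b. (\<forall>t\<in>{a..b}. 0 \<le> f t) \<longrightarrow> (\<forall>t\<in>{a..b}. 0 \<le> T f t))"

text \<open>
  Sequences and matrices are indexed by the positive integers: they are functions on \<^typ>\<open>nat\<close>
  whose values at index 0 are never used.
\<close>

definition deferred_weight_sum :: "(nat \<Rightarrow> nat) \<Rightarrow> (nat \<Rightarrow> nat) \<Rightarrow> (nat \<Rightarrow> real) \<Rightarrow> nat \<Rightarrow> real" where
  "deferred_weight_sum b c s n = (\<Sum>m = b n + 1..c n. s m)"

definition deferred_weighted_summable ::
  "(nat \<Rightarrow> nat) \<Rightarrow> (nat \<Rightarrow> nat) \<Rightarrow> (nat \<Rightarrow> real) \<Rightarrow> (nat \<Rightarrow> real) \<Rightarrow> real \<Rightarrow> bool" where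
  "deferred_weighted_summable b c s x l \<longleftrightarrow>
     (\<lambda>n. 1 / deferred_weight_sum b c s n * (\<Sum>m = b n + 1..c n. s m * x m)) \<longlonglongrightarrow> l"

text \<open>
  \<open>(Ax)\<^sub>n\<close> is an ordinary, possibly only conditionally convergent, series over \<open>k \<ge> 1\<close>;
  hence the index shift.
\<close>

definition deferred_weighted_regular ::
  "(nat \<Rightarrow> nat) \<Rightarrow> (nat \<Rightarrow> nat) \<Rightarrow> (nat \<Rightarrow> real) \<Rightarrow> (nat \<Rightarrow> nat \<Rightarrow> real) \<Rightarrow> bool" where
  "deferred_weighted_regular b c s A \<longleftrightarrow>
     (\<forall>x l. x \<longlonglongrightarrow> l \<longrightarrow>
        (\<forall>n\<ge>1. summable (\<lambda>k. A n (Suc k) * x (Suc k))) \<and>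
        deferred_weighted_summable b c s (\<lambda>n. \<Sum>k. A n (Suc k) * x (Suc k)) l)"

definition nonneg_matrix :: "(nat \<Rightarrow> nat \<Rightarrow> real) \<Rightarrow> bool" where
  "nonneg_matrix A \<longleftrightarrow> (\<forall>n\<ge>1. \<forall>k\<ge>1. 0 \<le> A n k)"

text \<open>
  Only meant for non-negative deferred weighted regular \<open>A\<close>. The rows of such a matrix are
  summable (apply regularity to the constant sequence 1), so the unordered sums below are
  genuine sums and do not fall back on the default value 0.
\<close>

definition DW_A_stat_lim ::
  "(nat \<Rightarrow> nat) \<Rightarrow> (nat \<Rightarrow> nat) \<Rightarrow> (nat \<Rightarrow> real) \<Rightarrow> (nat \<Rightarrow> nat \<Rightarrow> real) \<Rightarrow> (nat \<Rightarrow> real) \<Rightarrow> real \<Rightarrow> bool"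
  where
  "DW_A_stat_lim b c s A x l \<longleftrightarrow>
     (\<forall>\<epsilon>>0. (\<lambda>n. 1 / deferred_weight_sum b c s n *
        (\<Sum>m = b n + 1..c n. \<Sum>\<^sub>\<infinity>k\<in>{k. k \<ge> 1 \<and> \<bar>x k - l\<bar> \<ge> \<epsilon>}. s m * A m k)) \<longlonglongrightarrow> 0)"

end

theory Submission
  imports Defs
begin

text \<open>
  Korovkin's argument: by uniform continuity, \<open>\<bar>g t - g x\<bar> \<le> \<epsilon> + K (t - x)\<^sup>2\<close> on \<open>[a,b]\<close>.
  Applying a positive linear operator in \<open>t\<close> and evaluating at \<open>x\<close> bounds the error for \<open>g\<close> by
  \<open>\<epsilon>\<close> plus a constant multiple of the errors for \<open>1, t, t\<^sup>2\<close>, with a constant that does not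
  depend on the operator. Hence each exceptional set for \<open>g\<close> is covered by exceptional sets
  for the three monomials.
\<close>

section \<open>Positive linear operators on restricted functions, and quadratic bounds\<close>

lemma restrict_in_continuous_funs:
  "continuous_on {a..b} f \<Longrightarrow> (\<lambda>t\<in>{a..b}. f t) \<in> continuous_funs a b"
  unfolding continuous_funs_def
  by (auto intro: continuous_on_eq)

text \<open>\<open>linear_operator\<close> speaks about extensional functions, which would nest
  restrictions inside restrictions. Since these collapse on \<open>{a..b}\<close>, additivity can be
  used for any expressions continuous there, evaluated at a point.\<close>

lemma operator_add:
  assumes "linear_operator a b T" "continuous_on {a..b} f" "continuous_on {a..b} g" "x \<in> {a..b}"
  shows "T (\<lambda>t\<in>{a..b}. f t + g t) x = T (\<lambda>t\<in>{a..b}. f t) x + T (\<lambda>t\<in>{a..b}. g t) x"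
proof -
  let ?f = "\<lambda>t\<in>{a..b}. f t" and ?g = "\<lambda>t\<in>{a..b}. g t"
  have "T (\<lambda>t\<in>{a..b}. ?f t + ?g t) = (\<lambda>t\<in>{a..b}. T ?f t + T ?g t)"
    using assms(1) restrict_in_continuous_funs[OF assms(2)] restrict_in_continuous_funs[OF assms(3)]
    unfolding linear_operator_def by blast
  moreover have "(\<lambda>t\<in>{a..b}. ?f t + ?g t) = (\<lambda>t\<in>{a..b}. f t + g t)"
    by (auto simp: restrict_def)
  ultimately show ?thesis
    using assms(4) by simp
qed

lemma operator_scale:
  assumes "linear_operator a b T" "continuous_on {a..b} f" "x \<in> {a..b}"
  shows "T (\<lambda>t\<in>{a..b}. r * f t) x = r * T (\<lambda>t\<in>{a..b}. f t) x"
proof -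
  let ?f = "\<lambda>t\<in>{a..b}. f t"
  have "T (\<lambda>t\<in>{a..b}. r * ?f t) = (\<lambda>t\<in>{a..b}. r * T ?f t)"
    using assms(1) restrict_in_continuous_funs[OF assms(2)]
    unfolding linear_operator_def by blast
  moreover have "(\<lambda>t\<in>{a..b}. r * ?f t) = (\<lambda>t\<in>{a..b}. r * f t)"
    by (auto simp: restrict_def)
  ultimately show ?thesis
    using assms(3) by simp
qed

text \<open>Positivity is applied to the difference, written as \<open>g t + -1 * f t\<close> so
  that additivity and homogeneity take it apart.\<close>

lemma operator_mono:
  assumes "linear_operator a b T" "positive_operator a b T"
    and "continuous_on {a..b} f" "continuous_on {a..b} g"
    and "\<And>t. t \<in> {a..b} \<Longrightarrow> f t \<le> g t" and x: "x \<in> {a..b}"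
  shows "T (\<lambda>t\<in>{a..b}. f t) x \<le> T (\<lambda>t\<in>{a..b}. g t) x"
proof -
  have cont: "continuous_on {a..b} (\<lambda>t. -1 * f t)" "continuous_on {a..b} (\<lambda>t. g t + -1 * f t)"
    using assms(3,4) by (auto intro!: continuous_intros)
  have "0 \<le> T (\<lambda>t\<in>{a..b}. g t + -1 * f t) x"
    using assms(2,5) x restrict_in_continuous_funs[OF cont(2)]
    unfolding positive_operator_def by fastforce
  also have "\<dots> = T (\<lambda>t\<in>{a..b}. g t) x + T (\<lambda>t\<in>{a..b}. -1 * f t) x"
    by (rule operator_add[OF assms(1,4) cont(1) x])
  also have "T (\<lambda>t\<in>{a..b}. -1 * f t) x = -1 * T (\<lambda>t\<in>{a..b}. f t) x"
    by (rule operator_scale[OF assms(1,3) x])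
  finally show ?thesis
    by linarith
qed

lemma operator_quadratic:
  assumes "linear_operator a b T" "x \<in> {a..b}"
  shows "T (\<lambda>t\<in>{a..b}. p + (q * t + r * t\<^sup>2)) x =
    p * T (\<lambda>t\<in>{a..b}. t ^ 0) x + q * T (\<lambda>t\<in>{a..b}. t ^ 1) x + r * T (\<lambda>t\<in>{a..b}. t ^ 2) x"
proof -
  \<comment> \<open>Writing the constant as \<open>p * t ^ 0\<close> makes all three terms multiples
    of monomials; \<open>t ^ 0\<close> is 1 also at \<open>t = 0\<close>.\<close>
  have "T (\<lambda>t\<in>{a..b}. p * t ^ 0 + (q * t ^ 1 + r * t\<^sup>2)) x =
    T (\<lambda>t\<in>{a..b}. p * t ^ 0) x + (T (\<lambda>t\<in>{a..b}. q * t ^ 1) x + T (\<lambda>t\<in>{a..b}. r * t\<^sup>2) x)"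
    by (simp only: operator_add[OF assms(1) _ _ assms(2)] continuous_intros)
  also have "\<dots> = p * T (\<lambda>t\<in>{a..b}. t ^ 0) x +
      (q * T (\<lambda>t\<in>{a..b}. t ^ 1) x + r * T (\<lambda>t\<in>{a..b}. t ^ 2) x)"
    by (simp only: operator_scale[OF assms(1) _ assms(2)] continuous_intros)
  finally show ?thesis
    by simp
qed

text \<open>Uniform continuity handles points closer than \<delta>. At distance at least \<delta>,
  the factor \<open>(t - x)\<^sup>2 / \<delta>\<^sup>2\<close> is at least 1, so
  \<open>K = 2 * M / \<delta>\<^sup>2\<close> absorbs the crude bound \<open>2 * M\<close>, where
  \<open>M\<close> bounds \<open>g\<close>.\<close>

lemma continuous_quadratic_modulus:
  fixes g :: "real \<Rightarrow> real"
  assumes "continuous_on {a..b} g" "\<epsilon> > 0"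
  obtains K where "K \<ge> 0"
    "\<And>x t. x \<in> {a..b} \<Longrightarrow> t \<in> {a..b} \<Longrightarrow> \<bar>g t - g x\<bar> \<le> \<epsilon> + K * (t - x)\<^sup>2"
proof -
  obtain \<delta> where \<delta>: "\<delta> > 0"
    and unif: "\<And>x t. x \<in> {a..b} \<Longrightarrow> t \<in> {a..b} \<Longrightarrow> dist t x < \<delta> \<Longrightarrow> dist (g t) (g x) < \<epsilon>"
    using compact_uniformly_continuous[OF assms(1)] assms(2)
    unfolding uniformly_continuous_on_def by (metis compact_Icc)
  have "bounded (g ` {a..b})"
    using assms(1) by (intro compact_imp_bounded compact_continuous_image) auto
  then obtain M where M: "M > 0" "\<And>t. t \<in> {a..b} \<Longrightarrow> \<bar>g t\<bar> \<le> M"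
    unfolding bounded_pos by auto
  show thesis
  proof (rule that[of "2 * M / \<delta>\<^sup>2"])
    show "2 * M / \<delta>\<^sup>2 \<ge> 0"
      using M(1) by simp
    fix x t assume xt: "x \<in> {a..b}" "t \<in> {a..b}"
    show "\<bar>g t - g x\<bar> \<le> \<epsilon> + 2 * M / \<delta>\<^sup>2 * (t - x)\<^sup>2"
    proof (cases "\<bar>t - x\<bar> < \<delta>")
      case True
      then have "\<bar>g t - g x\<bar> \<le> \<epsilon>"
        using unif[OF xt] by (simp add: dist_real_def)
      moreover have "0 \<le> 2 * M / \<delta>\<^sup>2 * (t - x)\<^sup>2"
        using M(1) by simp
      ultimately show ?thesis
        by linarith
    next
      case False
      then have "\<delta>\<^sup>2 \<le> (t - x)\<^sup>2"
        using \<delta> by (metis less_eq_real_def linorder_not_less power2_abs power_mono)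
      then have "2 * M * 1 \<le> 2 * M * ((t - x)\<^sup>2 / \<delta>\<^sup>2)"
        using \<delta> M(1) by (intro mult_left_mono) auto
      moreover have "\<bar>g t - g x\<bar> \<le> 2 * M"
        using M(2)[OF xt(1)] M(2)[OF xt(2)] by linarith
      ultimately show ?thesis
        using assms(2) by simp
    qed
  qed
qed

section \<open>Sup-norm errors and the uniform Korovkin estimate\<close>

lemma abs_le_sup_norm:
  assumes "bounded (f ` {a..b})" "t \<in> {a..b}"
  shows "\<bar>f t\<bar> \<le> sup_norm a b f"
proof -
  obtain B where "\<And>t. t \<in> {a..b} \<Longrightarrow> \<bar>f t\<bar> \<le> B"
    using assms(1) unfolding bounded_real by blast
  then show ?thesis
    unfolding sup_norm_def using assms(2)
    by (intro cSUP_upper bdd_aboveI2[where M = B]) auto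
qed

lemma sup_norm_nonneg:
  assumes "a \<le> b" "bounded (f ` {a..b})"
  shows "0 \<le> sup_norm a b f"
  using abs_le_sup_norm[OF assms(2), of a] assms(1) by auto

lemma bounded_operator_error:
  assumes "linear_operator a b T" "g \<in> continuous_funs a b"
  shows "bounded ((\<lambda>t. T g t - g t) ` {a..b})"
proof (rule bounded_minus_comp)
  show "bounded (T g ` {a..b})"
    using assms unfolding linear_operator_def bounded_funs_def by auto
  show "bounded (g ` {a..b})"
    using assms(2) unfolding continuous_funs_def
    by (intro compact_imp_bounded compact_continuous_image) auto
qed

text \<open>For fixed \<open>x\<close>, \<open>g\<close> lies between the parabolas
  \<open>g x - (\<epsilon> + K * (t - x)\<^sup>2)\<close> and
  \<open>g x + (\<epsilon> + K * (t - x)\<^sup>2)\<close>. A positive \<open>T\<close> keeps this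
  order, and its values on parabolas are determined by the monomials. The bounds \<open>M\<close>
  for \<open>g\<close> and \<open>c\<close> for \<open>x\<close> make the outcome uniform in
  \<open>x\<close>.\<close>

lemma korovkin_estimate:
  assumes "a \<le> b" and g: "g \<in> continuous_funs a b" and "\<epsilon> > 0"
  obtains C where "C > 0"
    "\<And>T. linear_operator a b T \<Longrightarrow> positive_operator a b T \<Longrightarrow>
      sup_norm a b (\<lambda>t. T g t - g t) \<le>
        \<epsilon> + C * (\<Sum>i\<in>{0, 1, 2}. sup_norm a b (\<lambda>t. T (\<lambda>t\<in>{a..b}. t ^ i) t - (\<lambda>t\<in>{a..b}. t ^ i) t))"
proof -
  have cont_g: "continuous_on {a..b} g" and ext_g: "(\<lambda>t\<in>{a..b}. g t) = g"
    using g by (auto simp: continuous_funs_def extensional_restrict)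
  obtain K where K: "K \<ge> 0"
    and modulus: "\<And>x t. x \<in> {a..b} \<Longrightarrow> t \<in> {a..b} \<Longrightarrow> \<bar>g t - g x\<bar> \<le> \<epsilon> + K * (t - x)\<^sup>2"
    using continuous_quadratic_modulus[OF cont_g \<open>\<epsilon> > 0\<close>] by metis
  have "bounded (g ` {a..b})"
    using cont_g by (intro compact_imp_bounded compact_continuous_image) auto
  then obtain M where M: "M > 0" "\<And>t. t \<in> {a..b} \<Longrightarrow> \<bar>g t\<bar> \<le> M"
    unfolding bounded_pos by auto
  define c where "c = max \<bar>a\<bar> \<bar>b\<bar>"
  have c: "c \<ge> 0" "\<And>x. x \<in> {a..b} \<Longrightarrow> \<bar>x\<bar> \<le> c"
    unfolding c_def by auto
  \<comment> \<open>The three summands are the coefficients that the errors of \<open>1\<close>,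
    \<open>t\<close> and \<open>t\<^sup>2\<close> receive in the pointwise bound; being
    non-negative, each is at most their sum.\<close>
  define C where "C = (\<epsilon> + K * c\<^sup>2 + M) + 2 * K * c + K"
  show thesis
  proof (rule that[of C])
    show "C > 0"
      unfolding C_def using \<open>\<epsilon> > 0\<close> K M(1) c(1) by (simp add: add_pos_nonneg)
    fix T assume lin: "linear_operator a b T" and pos: "positive_operator a b T"
    let ?e = "\<lambda>i. \<lambda>t\<in>{a..b}. t ^ i"
    define \<alpha> where "\<alpha> i = sup_norm a b (\<lambda>t. T (?e i) t - ?e i t)" for i :: nat
    have bdd: "bounded ((\<lambda>t. T (?e i) t - ?e i t) ` {a..b})" for i
      by (intro bounded_operator_error[OF lin] restrict_in_continuous_funs continuous_intros)
    have \<alpha>_nonneg: "\<alpha> i \<ge> 0" for i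
      unfolding \<alpha>_def by (rule sup_norm_nonneg[OF \<open>a \<le> b\<close> bdd])
    have pointwise: "\<bar>T g x - g x\<bar> \<le> \<epsilon> + C * (\<alpha> 0 + \<alpha> 1 + \<alpha> 2)" if x: "x \<in> {a..b}" for x
    proof -
      define u where "u i = T (?e i) x - x ^ i" for i
      have u: "\<bar>u i\<bar> \<le> \<alpha> i" for i
        using abs_le_sup_norm[OF bdd x] x unfolding \<alpha>_def u_def by auto
      have T_e: "T (?e i) x = x ^ i + u i" for i
        unfolding u_def by simp
      \<comment> \<open>\<open>Q\<close> is \<open>T\<close> applied to
        \<open>\<epsilon> + K * (t - x)\<^sup>2\<close> in the variable \<open>t\<close> and
        evaluated at \<open>x\<close>: in the expansion with \<open>T_e\<close> the terms
        \<open>x\<^sup>2 - 2 * x\<^sup>2 + x\<^sup>2\<close> cancel, leaving only the errors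
        \<open>u i\<close> next to \<epsilon>.\<close>
      define Q where "Q = \<epsilon> * (1 + u 0) + K * (u 2 - 2 * x * u 1 + x\<^sup>2 * u 0)"
      have upper: "T g x \<le> g x * (1 + u 0) + Q"
      proof -
        \<comment> \<open>The upper parabola is expanded in powers of \<open>t\<close> to match
          \<open>operator_quadratic\<close>; its constant \<open>g x\<close> contributes
          \<open>g x * (1 + u 0)\<close>.\<close>
        have "T (\<lambda>t\<in>{a..b}. g t) x \<le>
            T (\<lambda>t\<in>{a..b}. (g x + \<epsilon> + K * x\<^sup>2) + ((- 2 * K * x) * t + K * t\<^sup>2)) x"
        proof (rule operator_mono[OF lin pos cont_g _ _ x])
          fix t assume "t \<in> {a..b}"
          then show "g t \<le> (g x + \<epsilon> + K * x\<^sup>2) + ((- 2 * K * x) * t + K * t\<^sup>2)"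
            using modulus[OF x, of t] by (simp add: power2_eq_square algebra_simps abs_le_iff)
        qed (intro continuous_intros)
        then show ?thesis
          unfolding operator_quadratic[OF lin x] T_e ext_g Q_def
          by (simp add: power2_eq_square algebra_simps)
      qed
      have lower: "g x * (1 + u 0) - Q \<le> T g x"
      proof -
        have "T (\<lambda>t\<in>{a..b}. (g x - \<epsilon> - K * x\<^sup>2) + ((2 * K * x) * t + (- K) * t\<^sup>2)) x \<le>
            T (\<lambda>t\<in>{a..b}. g t) x"
        proof (rule operator_mono[OF lin pos _ cont_g _ x])
          fix t assume "t \<in> {a..b}"
          then show "(g x - \<epsilon> - K * x\<^sup>2) + ((2 * K * x) * t + (- K) * t\<^sup>2) \<le> g t"
            using modulus[OF x, of t] by (simp add: power2_eq_square algebra_simps abs_le_iff)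
        qed (intro continuous_intros)
        then show ?thesis
          unfolding operator_quadratic[OF lin x] T_e ext_g Q_def
          by (simp add: power2_eq_square algebra_simps)
      qed
      have u_le: "u i \<le> \<alpha> i" for i
        using u[of i] by linarith
      have gu: "\<bar>g x * u 0\<bar> \<le> M * \<alpha> 0"
        unfolding abs_mult using M x u[of 0] by (intro mult_mono) auto
      have xu1: "\<bar>x * u 1\<bar> \<le> c * \<alpha> 1"
        unfolding abs_mult using c x u[of 1] by (intro mult_mono) auto
      have "x\<^sup>2 \<le> c\<^sup>2"
        using c(2)[OF x] by (metis abs_ge_zero power2_abs power_mono)
      then have "\<bar>x\<^sup>2 * u 0\<bar> \<le> c\<^sup>2 * \<alpha> 0"
        unfolding abs_mult using u[of 0] by (intro mult_mono) auto
      then have "u 2 - 2 * x * u 1 + x\<^sup>2 * u 0 \<le> \<alpha> 2 + 2 * (c * \<alpha> 1) + c\<^sup>2 * \<alpha> 0"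
        using u_le[of 2] xu1 by linarith
      then have "K * (u 2 - 2 * x * u 1 + x\<^sup>2 * u 0) \<le> K * (\<alpha> 2 + 2 * (c * \<alpha> 1) + c\<^sup>2 * \<alpha> 0)"
        using K by (rule mult_left_mono)
      moreover have "\<epsilon> * (1 + u 0) \<le> \<epsilon> * (1 + \<alpha> 0)"
        using \<open>\<epsilon> > 0\<close> u_le[of 0] by (intro mult_left_mono) auto
      \<comment> \<open>The brackets \<open>upper\<close> and \<open>lower\<close> give
        \<open>\<bar>T g x - g x\<bar> \<le> \<bar>g x * u 0\<bar> + Q\<close>; the bounds on both
        terms are then collected by \<alpha>.\<close>
      ultimately have "\<bar>T g x - g x\<bar> \<le>
          \<epsilon> + (\<epsilon> + K * c\<^sup>2 + M) * \<alpha> 0 + (2 * K * c) * \<alpha> 1 + K * \<alpha> 2"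
        using upper lower gu unfolding Q_def by (auto simp: algebra_simps abs_le_iff)
      moreover have "(\<epsilon> + K * c\<^sup>2 + M) * \<alpha> 0 \<le> C * \<alpha> 0" "(2 * K * c) * \<alpha> 1 \<le> C * \<alpha> 1"
        "K * \<alpha> 2 \<le> C * \<alpha> 2"
        unfolding C_def using \<open>\<epsilon> > 0\<close> K M(1) c(1) \<alpha>_nonneg by (intro mult_right_mono; simp)+
      ultimately show ?thesis
        by (simp add: distrib_left)
    qed
    have "sup_norm a b (\<lambda>t. T g t - g t) \<le> \<epsilon> + C * (\<alpha> 0 + \<alpha> 1 + \<alpha> 2)"
      unfolding sup_norm_def using \<open>a \<le> b\<close> pointwise by (intro cSUP_least) auto
    then show "sup_norm a b (\<lambda>t. T g t - g t) \<le>
        \<epsilon> + C * (\<Sum>i\<in>{0, 1, 2}. sup_norm a b (\<lambda>t. T (?e i) t - ?e i t))"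
      unfolding \<alpha>_def[symmetric] by (simp add: add.assoc)
  qed
qed

section \<open>Covers of exceptional sets and statistical convergence\<close>

lemma infsum_le_sum_cover:
  fixes f :: "'a \<Rightarrow> real"
  assumes "finite I" "f summable_on (\<Union>i\<in>I. X i)" "\<And>x. x \<in> (\<Union>i\<in>I. X i) \<Longrightarrow> 0 \<le> f x"
    and "K \<subseteq> (\<Union>i\<in>I. X i)"
  shows "infsum f K \<le> (\<Sum>i\<in>I. infsum f (X i))"
  using assms
proof (induction I arbitrary: K rule: finite_induct)
  case empty
  then show ?case by simp
next
  case (insert j I)
  let ?U = "\<Union>i\<in>I. X i"
  have summ: "f summable_on Y" if "Y \<subseteq> (\<Union>i\<in>insert j I. X i)" for Y
    using insert.prems(1) that by (rule summable_on_subset)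
  have "infsum f K \<le> infsum f (X j \<union> (?U - X j))"
    using insert.prems by (intro infsum_mono2 summ) auto
  \<comment> \<open>The sets \<open>X i\<close> may overlap, so \<open>X j\<close> is removed from
    the rest before splitting the sum. The remainder is merely a subset of \<open>?U\<close>, hence
    the induction over arbitrary \<open>K\<close>.\<close>
  also have "\<dots> = infsum f (X j) + infsum f (?U - X j)"
    by (intro infsum_Un_disjoint summ) auto
  also have "infsum f (?U - X j) \<le> (\<Sum>i\<in>I. infsum f (X i))"
    using insert.prems by (intro insert.IH summ) auto
  finally show ?case
    using insert.hyps by simp
qed

text \<open>Regularity applied to the constant sequence 1 makes the shifted row a convergent series;
  non-negativity turns this into unordered summability, which passes to subsets. So
  \<open>infsum\<close> over any set of positive indices is a genuine sum.\<close>

lemma regular_row_summable: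
  assumes "nonneg_matrix A" "deferred_weighted_regular b c s A" "m \<ge> 1" "X \<subseteq> {1..}"
  shows "A m summable_on X"
proof -
  have "summable (\<lambda>k. A m (Suc k))"
    using assms(2,3) tendsto_const[of "1 :: real" sequentially]
    unfolding deferred_weighted_regular_def by fastforce
  then have "(\<lambda>k. A m (Suc k)) summable_on UNIV"
    using assms(1,3) by (intro summable_nonneg_imp_summable_on) (auto simp: nonneg_matrix_def)
  then have "A m summable_on range Suc"
    by (subst summable_on_reindex) (auto simp: o_def)
  moreover have "X \<subseteq> range Suc"
    using assms(4) by (auto simp: image_iff Suc_le_eq gr0_conv_Suc)
  ultimately show ?thesis
    by (rule summable_on_subset)
qed

text \<open>The weighted mass of an index set is monotone and finitely subadditive. An exceptional
  set covered by finitely many sets of vanishing mass therefore has vanishing mass itself, by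
  squeezing.\<close>

lemma DW_A_stat_lim_dominated:
  assumes "nonneg_matrix A" "deferred_weighted_regular b c s A"
    and s: "\<And>n. n \<ge> 1 \<Longrightarrow> s n \<ge> 0" and S: "\<And>n. n \<ge> 1 \<Longrightarrow> deferred_weight_sum b c s n > 0"
    and "finite I" and x: "\<And>i. i \<in> I \<Longrightarrow> DW_A_stat_lim b c s A (x i) (l i)"
    and cover: "\<And>\<epsilon>. \<epsilon> > 0 \<Longrightarrow>
      \<exists>\<delta>>0. \<forall>k\<ge>1. \<bar>y k - l'\<bar> \<ge> \<epsilon> \<longrightarrow> (\<exists>i\<in>I. \<bar>x i k - l i\<bar> \<ge> \<delta>)"
  shows "DW_A_stat_lim b c s A y l'"
  unfolding DW_A_stat_lim_def
proof (intro allI impI)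
  fix \<epsilon> :: real assume "\<epsilon> > 0"
  then obtain \<delta> where \<delta>: "\<delta> > 0"
    and cov: "\<And>k. k \<ge> 1 \<Longrightarrow> \<bar>y k - l'\<bar> \<ge> \<epsilon> \<Longrightarrow> \<exists>i\<in>I. \<bar>x i k - l i\<bar> \<ge> \<delta>"
    using cover by metis
  let ?K = "{k. k \<ge> 1 \<and> \<bar>y k - l'\<bar> \<ge> \<epsilon>}"
  let ?X = "\<lambda>i. {k. k \<ge> 1 \<and> \<bar>x i k - l i\<bar> \<ge> \<delta>}"
  let ?D = "\<lambda>n X. 1 / deferred_weight_sum b c s n * (\<Sum>m = b n + 1..c n. \<Sum>\<^sub>\<infinity>k\<in>X. s m * A m k)"
  have nonneg: "0 \<le> s m * A m k" if "m \<ge> 1" "k \<ge> 1" for m k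
    using that s assms(1) by (simp add: nonneg_matrix_def)
  \<comment> \<open>Only rows \<open>m \<ge> 1\<close> occur, since the weighted sums start at
    \<open>b n + 1\<close>; sign and summability are known exactly for these rows.\<close>
  have row_le: "(\<Sum>\<^sub>\<infinity>k\<in>?K. s m * A m k) \<le> (\<Sum>i\<in>I. \<Sum>\<^sub>\<infinity>k\<in>?X i. s m * A m k)"
    if "m \<ge> 1" for m
    using nonneg[OF that] cov
    by (intro infsum_le_sum_cover[OF \<open>finite I\<close>] summable_on_cmult_right
        regular_row_summable[OF assms(1,2) that]) auto
  show "(\<lambda>n. ?D n ?K) \<longlonglongrightarrow> 0"
  proof (rule tendsto_sandwich)
    \<comment> \<open>Both squeezing bounds are claimed only eventually because the weight sum is
      known to be positive only for \<open>n \<ge> 1\<close>.\<close>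
    show "\<forall>\<^sub>F n in sequentially. 0 \<le> ?D n ?K"
      using eventually_ge_at_top[of 1]
    proof eventually_elim
      case (elim n)
      show ?case
        using S[OF elim]
        by (intro mult_nonneg_nonneg[OF _ sum_nonneg[OF infsum_nonneg[OF nonneg]]]) auto
    qed
    show "\<forall>\<^sub>F n in sequentially. ?D n ?K \<le> (\<Sum>i\<in>I. ?D n (?X i))"
      using eventually_ge_at_top[of 1]
    proof eventually_elim
      case (elim n)
      have "?D n ?K \<le> 1 / deferred_weight_sum b c s n *
          (\<Sum>m = b n + 1..c n. \<Sum>i\<in>I. \<Sum>\<^sub>\<infinity>k\<in>?X i. s m * A m k)"
        using S[OF elim] by (intro mult_left_mono sum_mono row_le) auto
      also have "\<dots> = (\<Sum>i\<in>I. ?D n (?X i))"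
        by (subst sum.swap) (simp add: sum_distrib_left)
      finally show ?case .
    qed
    have "(\<lambda>n. ?D n (?X i)) \<longlonglongrightarrow> 0" if "i \<in> I" for i
      using x[OF that] \<delta> unfolding DW_A_stat_lim_def by blast
    then show "(\<lambda>n. \<Sum>i\<in>I. ?D n (?X i)) \<longlonglongrightarrow> 0"
      by (intro tendsto_null_sum) auto
  qed simp
qed

section \<open>Transfer between the three monomials and all continuous functions\<close>

theorem theorem1:
  fixes a b :: real
    and L :: "nat \<Rightarrow> (real \<Rightarrow> real) \<Rightarrow> real \<Rightarrow> real"
    and bs cs :: "nat \<Rightarrow> nat"
    and s :: "nat \<Rightarrow> real"
    and A :: "nat \<Rightarrow> nat \<Rightarrow> real"
    and e :: "nat \<Rightarrow> real \<Rightarrow> real"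
  assumes "a < b"
    and "\<And>n. n \<ge> 1 \<Longrightarrow> linear_operator a b (L n)"
    and "\<And>n. n \<ge> 1 \<Longrightarrow> positive_operator a b (L n)"
    and "\<And>n. n \<ge> 1 \<Longrightarrow> bs n < cs n"
    and "filterlim cs at_top sequentially"
    and "\<And>n. n \<ge> 1 \<Longrightarrow> s n \<ge> 0"
    and "\<And>n. n \<ge> 1 \<Longrightarrow> deferred_weight_sum bs cs s n > 0"
    and "nonneg_matrix A"
    and "deferred_weighted_regular bs cs s A"
    and "\<And>i. e i = (\<lambda>t\<in>{a..b}. t ^ i)"
  shows "(\<forall>i\<in>{0, 1, 2}. DW_A_stat_lim bs cs s A (\<lambda>n. sup_norm a b (\<lambda>t. L n (e i) t - e i t)) 0)
     \<longleftrightarrow> (\<forall>g\<in>continuous_funs a b.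
            DW_A_stat_lim bs cs s A (\<lambda>n. sup_norm a b (\<lambda>t. L n g t - g t)) 0)"
proof
  let ?err = "\<lambda>g n. sup_norm a b (\<lambda>t. L n g t - g t)"
  have e_cont: "e i \<in> continuous_funs a b" for i
    unfolding assms(10) by (intro restrict_in_continuous_funs continuous_intros)
  show "\<forall>i\<in>{0, 1, 2}. DW_A_stat_lim bs cs s A (?err (e i)) 0"
    if "\<forall>g\<in>continuous_funs a b. DW_A_stat_lim bs cs s A (?err g) 0"
    using that e_cont by blast
  show "\<forall>g\<in>continuous_funs a b. DW_A_stat_lim bs cs s A (?err g) 0"
    if test: "\<forall>i\<in>{0, 1, 2}. DW_A_stat_lim bs cs s A (?err (e i)) 0"
  proof
    fix g assume g: "g \<in> continuous_funs a b"
    show "DW_A_stat_lim bs cs s A (?err g) 0"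
    proof (rule DW_A_stat_lim_dominated[OF assms(8,9,6,7)])
      show "finite {0, 1, 2 :: nat}"
        by simp
      show "DW_A_stat_lim bs cs s A (?err (e i)) 0" if "i \<in> {0, 1, 2}" for i
        using test that by blast
      fix \<epsilon> :: real assume "\<epsilon> > 0"
      \<comment> \<open>Half of \<epsilon> is spent on the modulus of \<open>g\<close>, so an error
        of at least \<epsilon> forces the monomial errors to account for the other half.\<close>
      obtain C where C: "C > 0"
        and est: "\<And>n. n \<ge> 1 \<Longrightarrow> ?err g n \<le> \<epsilon> / 2 + C * (\<Sum>i\<in>{0, 1, 2}. ?err (e i) n)"
      proof (rule korovkin_estimate[OF less_imp_le[OF assms(1)] g half_gt_zero[OF \<open>\<epsilon> > 0\<close>]])
        fix C :: real
        assume "C > 0" and "\<And>T. linear_operator a b T \<Longrightarrow> positive_operator a b T \<Longrightarrow>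
          sup_norm a b (\<lambda>t. T g t - g t) \<le> \<epsilon> / 2 + C * (\<Sum>i\<in>{0, 1, 2}.
            sup_norm a b (\<lambda>t. T (\<lambda>t\<in>{a..b}. t ^ i) t - (\<lambda>t\<in>{a..b}. t ^ i) t))"
        then show thesis
          using that assms(2,3) unfolding assms(10) by blast
      qed
      show "\<exists>\<delta>>0. \<forall>k\<ge>1. \<bar>?err g k - 0\<bar> \<ge> \<epsilon> \<longrightarrow> (\<exists>i\<in>{0, 1, 2}. \<bar>?err (e i) k - 0\<bar> \<ge> \<delta>)"
      proof (intro exI conjI allI impI)
        \<comment> \<open>The monomial errors must add up to at least
          \<open>\<epsilon> / (2 * C)\<close>; a third of this is the threshold that at least one of
          the three has to reach.\<close>
        show "\<epsilon> / (6 * C) > 0"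
          using \<open>\<epsilon> > 0\<close> C by simp
        fix k :: nat assume k: "k \<ge> 1" and large: "\<bar>?err g k - 0\<bar> \<ge> \<epsilon>"
        \<comment> \<open>This removes the absolute value in \<open>large\<close>, so that
          \<open>est\<close> applies to the error itself.\<close>
        have "0 \<le> ?err g k"
          using assms(1,2) k g by (intro sup_norm_nonneg bounded_operator_error) auto
        then have "\<epsilon> / 2 \<le> C * (\<Sum>i\<in>{0, 1, 2}. ?err (e i) k)"
          using est[OF k] large by linarith
        then have sum_ge: "\<epsilon> / (2 * C) \<le> (\<Sum>i\<in>{0, 1, 2}. ?err (e i) k)"
          using C by (simp add: field_simps)
        show "\<exists>i\<in>{0, 1, 2}. \<bar>?err (e i) k - 0\<bar> \<ge> \<epsilon> / (6 * C)"
        proof (rule ccontr)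
          assume "\<not> ?thesis"
          then have "\<forall>i\<in>{0, 1, 2}. ?err (e i) k < \<epsilon> / (6 * C)"
            by fastforce
          then have "(\<Sum>i\<in>{0, 1, 2}. ?err (e i) k) < 3 * (\<epsilon> / (6 * C))"
            by simp
          then show False
            using sum_ge by simp
        qed
      qed
    qed
  qed
qed

end
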